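(* Let $p$ be an odd prime, $t,s$ positive integers, $r=p^t$, $q=r^s$, $T=q+1$. Let $\eta$ be the quadratic multiplicative character of $\mathbb{F}_r$ (with $\eta(0)=0$), and let $$D=\{x\in\mathbb{F}_{q^2}:\ \eta(\mathrm{Tr}_{q/r}(x^T))=-1\},\qquad K=\#D=\frac{q(q+1)(r-1)}{2r}.$$ For $a\in\mathbb{F}_{q^2}$ let $\chi_a(x)=\zeta_p^{\mathrm{Tr}_{q^2/p}(ax)}$ ($\zeta_p=e^{2\pi i/p}$) and $\mathbf{c}_a=\frac{1}{\sqrt K}(\chi_a(x))_{x\in D}$, giving the codebook $\{\mathbf{c}_a:a\in\mathbb{F}_{q^2}\}$ with $N=q^2$. Then, as $(a_i,a_j)$ ranges over the $q^2(q^2-1)$ ordered pairs of distinct elements of $\mathbb{F}_{q^2}$, the inner product $\mathbf{c}_{a_i}\mathbf{c}_{a_j}^H$ takes the value $\frac{1}{K}\cdot\frac{r-1}{2r}q$ exactly $\frac{r+1}{2r}q^4-\frac{r-1}{2r}q^3-q^2$ times, and the value $\frac{1}{K}\cdot\frac{-r-1}{2r}q$ exactly $\frac{r-1}{2r}(q^4+q^3)$ times.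
   Context: $\mathrm{Tr}_{q/r}$ is the trace from $\mathbb{F}_q$ to $\mathbb{F}_r$ and $\mathrm{Tr}_{q^2/p}$ the absolute trace of $\mathbb{F}_{q^2}$; note $x^{q+1}\in\mathbb{F}_q$ for $x\in\mathbb{F}_{q^2}$. $\mathbf{c}^H$ is the conjugate transpose. *)

theory Defs
  imports Complex_Main "HOL-Computational_Algebra.Primes"
begin

text \<open>The finite field F_{q^2} is modelled as a type 'a of class field with
CARD('a) = q^2, q a power of the prime p. Subfields F_{p^m} are {x. x^(p^m) = x}.\<close>

definition rel_trace :: "nat \<Rightarrow> nat \<Rightarrow> 'a::field \<Rightarrow> 'a" where
  "rel_trace r n y = (\<Sum>i<n. y ^ (r ^ i))"

definition abs_trace_nat :: "nat \<Rightarrow> nat \<Rightarrow> 'a::field \<Rightarrow> nat" where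
  "abs_trace_nat p m x = (THE k. k < p \<and> of_nat k = rel_trace p m x)"

definition add_char :: "nat \<Rightarrow> nat \<Rightarrow> 'a::field \<Rightarrow> 'a \<Rightarrow> complex" where
  "add_char p m a x = cis (2 * pi * real (abs_trace_nat p m (a * x)) / real p)"

definition quad_char :: "nat \<Rightarrow> 'a::field \<Rightarrow> int" where
  "quad_char r y = (if y = 0 then 0
     else if (\<exists>z. z ^ r = z \<and> z ^ 2 = y) then 1 else -1)"

end

theory Submission
  imports Defs "HOL-Number_Theory.Residues" "HOL-Computational_Algebra.Polynomial"
begin

text \<open>Let \<open>Q x = Tr_{q/r}(x^(q+1))\<close>, a Hermitian form over \<open>F_r\<close>. Completing the square gives
  \<open>\<Sum>x. \<psi>(y Q x + b x) = -q \<psi>(-Q b / y)\<close> for nonzero \<open>y\<close> in \<open>F_r\<close>. Detecting \<open>Q x = 0\<close> by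
  orthogonality over \<open>F_r\<close>, and \<open>\<eta>(Q x)\<close> by a Gauss sum (which cancels at the end, so that only its
  nonvanishing matters), expresses the character sum of \<open>D\<close> at \<open>b\<close> through \<open>\<eta>(-Q b)\<close>. The same
  identity at \<open>b = 0\<close> counts \<open>D\<close>. The cardinalities of the subfields, the surjectivity of the traces and
  the fibres of the norm come from one counting argument: bounds on the numbers of roots of
  polynomials must be sharp when they add up to the size of the field.\<close>

section \<open>Counting by fibres\<close>

text \<open>The fibres over \<open>B\<close> partition \<open>A\<close>. At most \<open>m\<close>
  fibres of size at most \<open>k\<close> can add up to \<open>m * k\<close> only if there are
  exactly \<open>m\<close> of them and each has size \<open>k\<close>.\<close>

lemma fibres_full:
  assumes "finite A" "finite B" "f ` A \<subseteq> B" "card B \<le> m"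
    and fibre: "\<And>y. y \<in> B \<Longrightarrow> card {x \<in> A. f x = y} \<le> k"
    and "card A = m * k" "k > 0"
  shows "card B = m" and "y \<in> B \<Longrightarrow> card {x \<in> A. f x = y} = k"
proof -
  have A: "card A = (\<Sum>y\<in>B. card {x \<in> A. f x = y})"
    using sum.group[OF assms(1-3), of "\<lambda>_. 1 :: nat"] by simp
  have "m * k \<le> card B * k"
    using A assms(6) sum_mono[of B "\<lambda>y. card {x \<in> A. f x = y}" "\<lambda>_. k"] fibre by simp
  then show B: "card B = m"
    using assms(4,7) by simp
  have eq: "(\<Sum>y\<in>B. k - card {x \<in> A. f x = y}) = 0"
    using A B assms(6) by (subst sum_subtractf_nat) (simp_all add: fibre)
  show "card {x \<in> A. f x = y} = k" if "y \<in> B"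
    using eq fibre[OF that] assms(2) that by (auto intro: le_antisym)
qed

lemma card_roots_monic_le:
  fixes R :: "'a::{comm_ring_1,ring_no_zero_divisors} poly"
  assumes "degree R < n"
  shows "card {x. x ^ n + poly R x = 0} \<le> n"
proof -
  have deg: "degree (monom 1 n + R) = n"
    using assms by (subst degree_add_eq_left) (simp_all add: degree_monom_eq)
  then have "monom 1 n + R \<noteq> 0"
    using assms by auto
  from card_poly_roots_bound[OF this] show ?thesis
    by (simp add: deg poly_monom)
qed

lemma card_power_eq_le:
  fixes c :: "'a::{comm_ring_1,ring_no_zero_divisors}"
  assumes "n > 0"
  shows "card {x. x ^ n = c} \<le> n"
  using card_roots_monic_le[of "[:- c:]" n] assms by simp

text \<open>For \<open>n\<close> a power of the characteristic this is a subfield, playing the role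
  of F_n. Closure under products and quotients holds for every \<open>n\<close>; sums require
  Frobenius.\<close>

definition fixed_field :: "nat \<Rightarrow> 'a::field set" where
  "fixed_field n = {x. x ^ n = x}"

lemma fixed_field_mult: "x \<in> fixed_field n \<Longrightarrow> y \<in> fixed_field n \<Longrightarrow> (x * y :: 'a::field) \<in> fixed_field n"
  by (simp add: fixed_field_def power_mult_distrib)

lemma fixed_field_divide: "x \<in> fixed_field n \<Longrightarrow> y \<in> fixed_field n \<Longrightarrow> (x / y :: 'a::field) \<in> fixed_field n"
  by (simp add: fixed_field_def power_divide)

lemma fixed_field_0: "n > 0 \<Longrightarrow> (0 :: 'a::field) \<in> fixed_field n"
  and fixed_field_1: "(1 :: 'a::field) \<in> fixed_field n"
  by (simp_all add: fixed_field_def)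

lemma fixed_field_power: "x \<in> fixed_field n \<Longrightarrow> (x :: 'a::field) \<in> fixed_field (n ^ j)"
  by (induction j) (simp_all add: fixed_field_def power_mult)

lemma card_fixed_field_le:
  assumes "n > 1"
  shows "card (fixed_field n :: 'a::field set) \<le> n"
  using card_roots_monic_le[of "[:0, -1 :: 'a:]" n] assms by (simp add: fixed_field_def)

text \<open>A trace with \<open>Suc n\<close> terms is a monic polynomial of degree
  \<open>m ^ n\<close>; \<open>R\<close> collects the lower terms and the constant
  \<open>- c\<close>.\<close>

lemma card_rel_trace_fibre_le:
  fixes c :: "'a::field"
  assumes "m > 1"
  shows "card {x. rel_trace m (Suc n) x = c} \<le> m ^ n"
proof -
  define R where "R = (\<Sum>i<n. monom (1 :: 'a) (m ^ i)) - [:c:]"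
  have "degree R < m ^ n"
  proof (rule degree_lessI)
    show "R \<noteq> 0 \<or> 0 < m ^ n"
      using assms by simp
    show "\<forall>k\<ge>m ^ n. coeff R k = 0"
    proof (intro allI impI)
      fix k assume k: "k \<ge> m ^ n"
      have "m ^ n > 0"
        using assms by simp
      then obtain l where l: "k = Suc l"
        using k by (cases k) simp_all
      have "m ^ i \<noteq> k" if "i < n" for i
        using power_strict_increasing[OF that assms] k by linarith
      then show "coeff R k = 0"
        by (simp add: R_def coeff_sum l)
    qed
  qed
  from card_roots_monic_le[OF this] show ?thesis
    by (simp add: R_def rel_trace_def poly_sum poly_monom algebra_simps)
qed

section \<open>Fermat's theorem in a finite field, orthogonality of characters and roots of
  unity\<close>

lemma finite_field_power_card:
  fixes x :: "'a::{finite,field}"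
  shows "x ^ card (UNIV :: 'a set) = x"
proof (cases "x = 0")
  case False
  \<comment> \<open>Multiplication by \<open>x\<close> permutes the nonzero elements; cancelling
    their nonzero product leaves a power of \<open>x\<close> equal to 1.\<close>
  have "(\<Prod>y\<in>UNIV - {0}. x * y) = (\<Prod>y\<in>UNIV - {0}. y)"
    by (rule prod.reindex_bij_witness[of _ "\<lambda>y. y / x" "\<lambda>y. x * y"]) (use False in auto)
  then have "x ^ (card (UNIV :: 'a set) - 1) = 1"
    by (simp add: prod.distrib)
  moreover have "card (UNIV :: 'a set) > 0"
    by (simp add: finite_UNIV_card_ge_0)
  ultimately show ?thesis
    by (simp add: power_eq_if)
qed (simp add: finite_UNIV_card_ge_0)

text \<open>Translation by \<open>a\<close> is injective on the finite set \<open>A\<close>, hence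
  permutes it, and it multiplies the sum by \<chi>(a), which differs from 1.\<close>

lemma sum_nontrivial_character_eq_0:
  fixes \<chi> :: "'a::ab_group_add \<Rightarrow> 'b::idom"
  assumes "finite A" and add: "\<And>x y. x \<in> A \<Longrightarrow> y \<in> A \<Longrightarrow> x + y \<in> A"
    and hom: "\<And>x y. x \<in> A \<Longrightarrow> y \<in> A \<Longrightarrow> \<chi> (x + y) = \<chi> x * \<chi> y"
    and a: "a \<in> A" "\<chi> a \<noteq> 1"
  shows "(\<Sum>x\<in>A. \<chi> x) = 0"
proof -
  have inj: "inj_on (\<lambda>x. x + a) A"
    by simp
  have "(\<lambda>x. x + a) ` A = A"
    using endo_inj_surj[OF assms(1) _ inj] add a(1) by blast
  then have "(\<Sum>x\<in>A. \<chi> x) = (\<Sum>x\<in>A. \<chi> (x + a))"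
    using sum.reindex[OF inj, of \<chi>] by simp
  also have "\<dots> = (\<Sum>x\<in>A. \<chi> x) * \<chi> a"
    using hom a(1) by (simp add: sum_distrib_right)
  finally show ?thesis
    using a(2) by simp
qed

lemma cis_root_of_unity_mod:
  assumes "p > 0" "[j = k] (mod p)"
  shows "cis (2 * pi * real j / real p) = cis (2 * pi * real k / real p)"
proof -
  have *: "cis (2 * pi * real k / real p) = cis (2 * pi * real (k mod p) / real p)" for k
  proof -
    have "real k = real (k div p) * real p + real (k mod p)"
      by (metis div_mult_mod_eq of_nat_add of_nat_mult)
    then have "2 * pi * real k / real p = 2 * pi * real (k div p) + 2 * pi * real (k mod p) / real p"
      using assms(1) by (simp add: field_simps)
    then show ?thesis
      by (simp flip: cis_mult)
  qed
  show ?thesis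
    using *[of j] *[of k] assms(2) by (simp add: cong_def)
qed

section \<open>The tower of fields\<close>

locale odd_field_tower =
  fixes F :: "'a::{finite,field} itself" and p t s r q :: nat
  assumes prime_p: "prime p" and odd_p: "odd p" and t_pos: "t > 0" and s_pos: "s > 0"
    and r_def: "r = p ^ t" and q_def: "q = r ^ s" and card_UNIV: "card (UNIV :: 'a set) = q ^ 2"
begin

text \<open>The degree of F_{q^2} over its prime field.\<close>

definition m where "m = 2 * t * s"

lemma m_pos: "m > 0"
  using t_pos s_pos by (simp add: m_def)

lemma p_gt_1: "p > 1" and r_gt_1: "r > 1" and q_gt_1: "q > 1"
proof -
  show p: "p > 1" using prime_p prime_gt_1_nat by blast
  show r: "r > 1" unfolding r_def using p t_pos by (rule one_less_power)
  show "q > 1" unfolding q_def using r s_pos by (rule one_less_power)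
qed

lemma odd_r: "odd r"
  using odd_p by (simp add: r_def)

lemma q_eq: "q = p ^ (t * s)" and q_sq_eq: "q ^ 2 = p ^ m"
  by (simp_all add: q_def r_def m_def mult_ac flip: power_mult)

lemma CHAR_eq: "CHAR('a) = p"
proof -
  have "prime CHAR('a)"
    by (rule prime_CHAR_semidom) (simp add: finite_imp_CHAR_pos)
  moreover have "CHAR('a) dvd p ^ m"
    using CHAR_dvd_CARD[where ?'a = 'a] card_UNIV q_sq_eq by simp
  ultimately show ?thesis
    using prime_p by (meson prime_dvd_power primes_dvd_imp_eq)
qed

lemma two_neq_0: "(2 :: 'a) \<noteq> 0"
proof
  assume "(2 :: 'a) = 0"
  then have "p dvd 2"
    using of_nat_eq_0_iff_char_dvd[where ?'a = 'a, of 2] CHAR_eq by simp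
  then show False
    using odd_p p_gt_1 by (auto dest!: dvd_imp_le simp: le_Suc_eq numeral_2_eq_2)
qed

lemma frob_add: "n = p ^ k \<Longrightarrow> (x + y :: 'a) ^ n = x ^ n + y ^ n"
  using freshmans_dream'[where ?'a = 'a] prime_p CHAR_eq by blast

lemma frob_sum: "n = p ^ k \<Longrightarrow> (sum f A :: 'a) ^ n = (\<Sum>i\<in>A. f i ^ n)"
  using freshmans_dream_sum'[where ?'a = 'a] prime_p CHAR_eq by blast

lemma frob_uminus: "n = p ^ k \<Longrightarrow> (- x :: 'a) ^ n = - (x ^ n)"
  using odd_p by simp

lemma power_q_sq: "(x :: 'a) ^ (q ^ 2) = x"
  using finite_field_power_card[of x] card_UNIV by simp

lemma fixed_field_add: "n = p ^ k \<Longrightarrow> x \<in> fixed_field n \<Longrightarrow> y \<in> fixed_field n \<Longrightarrow> (x + y :: 'a) \<in> fixed_field n"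
  by (simp add: fixed_field_def frob_add)

lemma fixed_field_uminus: "n = p ^ k \<Longrightarrow> x \<in> fixed_field n \<Longrightarrow> (- x :: 'a) \<in> fixed_field n"
  by (simp add: fixed_field_def frob_uminus)

lemma fixed_field_of_nat: "n = p ^ k \<Longrightarrow> (of_nat j :: 'a) \<in> fixed_field n"
  using p_gt_1 by (induction j) (simp_all add: fixed_field_add fixed_field_0 fixed_field_1)

lemma fixed_field_2: "n = p ^ k \<Longrightarrow> (2 :: 'a) \<in> fixed_field n"
  using fixed_field_of_nat[of n k 2] by simp

section \<open>Images of the traces and sizes of the subfields\<close>

lemma rel_trace_in_fixed_field:
  assumes "n = p ^ a" "x \<in> fixed_field (n ^ k)"
  shows "(rel_trace n k x :: 'a) \<in> fixed_field n"
proof -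
  have "rel_trace n k x ^ n = (\<Sum>i<k. x ^ (n ^ Suc i))"
    by (simp add: rel_trace_def frob_sum[OF assms(1)] power_mult power_Suc2 del: power_Suc)
  \<comment> \<open>Frobenius shifts the summands by one place; the new last term equals the lost
    first one because \<open>x ^ (n ^ k) = x\<close>.\<close>
  moreover have "(\<Sum>i<k. x ^ (n ^ Suc i)) + x ^ n ^ 0 = (\<Sum>i<k. x ^ n ^ i) + x ^ n ^ k"
    using sum.lessThan_Suc_shift[of "\<lambda>i. x ^ n ^ i" k] by (simp add: add.commute)
  ultimately show ?thesis
    using assms(2) by (simp add: fixed_field_def rel_trace_def)
qed

text \<open>The trace sends \<open>n * n ^ (k - 1)\<close> elements into a set of at most
  \<open>n\<close>, with fibres of size at most \<open>n ^ (k - 1)\<close>, so both bounds are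
  attained. This passes the cardinality down from \<open>q ^ 2\<close> to \<open>q\<close> and
  \<open>p\<close>, and from \<open>q\<close> to \<open>r\<close>.\<close>

lemma rel_trace_onto_fixed_field:
  assumes n: "n = p ^ a" "a > 0" and k: "k > 0"
    and card: "card (fixed_field (n ^ k) :: 'a set) = n ^ k"
  shows "card (fixed_field n :: 'a set) = n"
    and "y \<in> fixed_field n \<Longrightarrow> \<exists>x\<in>fixed_field (n ^ k). rel_trace n k x = (y :: 'a)"
proof -
  have n1: "n > 1"
    unfolding n(1) using p_gt_1 n(2) by (rule one_less_power)
  have fibre: "card {x \<in> fixed_field (n ^ k). rel_trace n k x = y} \<le> n ^ (k - 1)" for y :: 'a
  proof -
    have "card {x \<in> fixed_field (n ^ k). rel_trace n k x = y} \<le> card {x. rel_trace n k x = y}"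
      by (intro card_mono) auto
    also have "\<dots> \<le> n ^ (k - 1)"
      using card_rel_trace_fibre_le[OF n1, of "k - 1" y] k by simp
    finally show ?thesis .
  qed
  have eq: "card (fixed_field (n ^ k) :: 'a set) = n * n ^ (k - 1)"
    using card k by (cases k) simp_all
  have img: "rel_trace n k ` fixed_field (n ^ k) \<subseteq> (fixed_field n :: 'a set)"
    using rel_trace_in_fixed_field[OF n(1)] by blast
  have pos: "n ^ (k - 1) > 0"
    using n1 by simp
  note full = fibres_full[OF _ _ img card_fixed_field_le[OF n1] fibre eq pos]
  show "card (fixed_field n :: 'a set) = n"
    by (rule full) simp_all
  show "\<exists>x\<in>fixed_field (n ^ k). rel_trace n k x = y" if "y \<in> fixed_field n"
  proof -
    have "card {x \<in> fixed_field (n ^ k). rel_trace n k x = y} > 0"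
      using full(2)[OF _ _ that] pos by simp
    then show ?thesis
      by (auto simp: card_gt_0_iff)
  qed
qed

lemma fixed_field_q_sq: "(fixed_field (q ^ 2) :: 'a set) = UNIV"
  by (simp add: fixed_field_def power_q_sq)

lemma card_fixed_field_q: "card (fixed_field q :: 'a set) = q"
  using s_pos t_pos
  by (intro rel_trace_onto_fixed_field(1)[of q "t * s" 2]) (simp_all add: q_eq[symmetric] fixed_field_q_sq card_UNIV)

lemma card_fixed_field_r: "card (fixed_field r :: 'a set) = r"
  using rel_trace_onto_fixed_field(1)[OF r_def t_pos s_pos] card_fixed_field_q by (simp add: q_def)

lemma rel_trace_onto_r: "y \<in> fixed_field r \<Longrightarrow> \<exists>x\<in>fixed_field q. rel_trace r s x = (y :: 'a)"
  using rel_trace_onto_fixed_field(2)[OF r_def t_pos s_pos] card_fixed_field_q by (simp add: q_def)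

lemma
  shows card_fixed_field_p: "card (fixed_field p :: 'a set) = p"
    and rel_trace_onto_p: "y \<in> fixed_field p \<Longrightarrow> \<exists>x. rel_trace p m x = (y :: 'a)"
proof -
  have "card (fixed_field (p ^ m) :: 'a set) = p ^ m"
    using card_UNIV fixed_field_q_sq by (simp add: q_sq_eq)
  note full = rel_trace_onto_fixed_field[of p 1 m, OF _ _ _ this]
  show "card (fixed_field p :: 'a set) = p"
    using full(1) m_pos by simp
  show "\<exists>x. rel_trace p m x = y" if "y \<in> fixed_field p"
    using full(2)[OF _ _ _ that] m_pos by auto
qed

lemma fixed_field_r_subset: "fixed_field r \<subseteq> (fixed_field q :: 'a set)"
  using fixed_field_power unfolding q_def by blast

subsection \<open>Additive characters\<close>

abbreviation \<psi> :: "'a \<Rightarrow> complex" where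
  "\<psi> \<equiv> add_char p m 1"

lemma add_char_eq: "add_char p m a x = \<psi> (a * x)"
  by (simp add: add_char_def)

lemma of_nat_eq_iff_cong: "of_nat j = (of_nat k :: 'a) \<longleftrightarrow> [j = k] (mod p)"
  using of_nat_eq_iff_cong_CHAR[where ?'a = 'a] CHAR_eq by simp

lemma fixed_field_p: "fixed_field p = (of_nat ` {..<p} :: 'a set)"
proof -
  have "inj_on (of_nat :: nat \<Rightarrow> 'a) {..<p}"
    by (auto simp: inj_on_def of_nat_eq_iff_cong cong_less_modulus_unique_nat)
  then have "card (of_nat ` {..<p} :: 'a set) = card (fixed_field p :: 'a set)"
    by (simp add: card_image card_fixed_field_p)
  moreover have "of_nat ` {..<p} \<subseteq> (fixed_field p :: 'a set)"
    using fixed_field_of_nat[of p 1] by auto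
  ultimately show ?thesis
    by (metis card_subset_eq finite)
qed

text \<open>The definite description in \<open>abs_trace_nat\<close> is meaningful: the trace lies
  in the prime field, whose elements have unique representatives below \<open>p\<close>.\<close>

lemma of_nat_abs_trace: "of_nat (abs_trace_nat p m x) = rel_trace p m (x :: 'a)"
proof -
  have "rel_trace p m x \<in> fixed_field p"
    using rel_trace_in_fixed_field[of p 1 x m] fixed_field_q_sq by (simp add: q_sq_eq)
  then obtain k where k: "k < p" "of_nat k = rel_trace p m x"
    by (auto simp: fixed_field_p)
  have "abs_trace_nat p m x = k"
    unfolding abs_trace_nat_def
    unfolding k(2)[symmetric] of_nat_eq_iff_cong
    by (rule the_equality) (use k(1) cong_less_modulus_unique_nat in auto)
  then show ?thesis
    using k by simp
qed

lemma psi_eq: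
  assumes "rel_trace p m x = of_nat k"
  shows "\<psi> x = cis (2 * pi * real k / real p)"
  unfolding add_char_def mult_1_left
  using assms of_nat_abs_trace[of x] p_gt_1
  by (intro cis_root_of_unity_mod) (simp_all flip: of_nat_eq_iff_cong)

lemma rel_trace_add: "n = p ^ k \<Longrightarrow> rel_trace n j (x + y :: 'a) = rel_trace n j x + rel_trace n j y"
  using frob_add[of "n ^ i" "k * i" for i]
  by (simp add: rel_trace_def sum.distrib flip: power_mult)

lemma psi_add: "\<psi> (x + y) = \<psi> x * \<psi> y"
proof -
  let ?k = "abs_trace_nat p m"
  have "rel_trace p m (x + y) = of_nat (?k x + ?k y)"
    using rel_trace_add[of p 1] by (simp add: of_nat_abs_trace)
  then have "\<psi> (x + y) = cis (2 * pi * real (?k x + ?k y) / real p)"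
    by (rule psi_eq)
  then show ?thesis
    by (simp add: add_char_def cis_mult ring_distribs add_divide_distrib)
qed

lemma psi_0: "\<psi> 0 = 1"
  using psi_eq[of 0 0] p_gt_1 by (simp add: rel_trace_def power_0_left)

lemma psi_uminus: "\<psi> (- x) = cnj (\<psi> x)"
proof -
  have "\<psi> (- x) * (\<psi> x * cnj (\<psi> x)) = cnj (\<psi> x)"
    using psi_add[of "- x" x] by (simp add: psi_0 mult.assoc[symmetric])
  moreover have "\<psi> x * cnj (\<psi> x) = 1"
    by (simp add: add_char_def cis_cnj cis_mult)
  ultimately show ?thesis
    by simp
qed

lemma psi_sum: "\<psi> (sum f A) = (\<Prod>i\<in>A. \<psi> (f i))"
  by (induction A rule: infinite_finite_induct) (simp_all add: psi_0 psi_add)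

text \<open>Frobenius permutes the summands of the absolute trace cyclically, since
  \<open>x ^ p ^ m = x\<close>.\<close>

lemma psi_frob_p: "\<psi> (x ^ p) = \<psi> x"
proof -
  have "rel_trace p m (x ^ p) + x = rel_trace p m x + x ^ p ^ m"
    using sum.lessThan_Suc_shift[of "\<lambda>i. x ^ p ^ i" m]
    by (simp add: rel_trace_def power_mult add.commute)
  then have "rel_trace p m (x ^ p) = rel_trace p m x"
    using power_q_sq[of x] by (simp add: q_sq_eq)
  then show ?thesis
    by (simp add: add_char_def abs_trace_nat_def)
qed

lemma psi_frob: "n = p ^ k \<Longrightarrow> \<psi> (x ^ n) = \<psi> x"
proof (induction k arbitrary: n)
  case (Suc k)
  then show ?case
    using psi_frob_p[of "x ^ p ^ k"] by (simp add: power_mult power_Suc2 del: power_Suc)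
qed simp

text \<open>An element of absolute trace 1 is sent to the primitive root of unity
  \<open>cis (2 * pi / real p)\<close>.\<close>

lemma psi_nontrivial: "\<exists>x. \<psi> x \<noteq> 1"
proof -
  obtain x :: 'a where "rel_trace p m x = 1"
    using rel_trace_onto_p fixed_field_1 by blast
  then have "\<psi> x = cis (2 * pi / real p)"
    using psi_eq[of x 1] by simp
  moreover have "cis (2 * pi / real p) \<noteq> 1"
  proof
    assume "cis (2 * pi / real p) = 1"
    then have "cos (2 * pi / real p) = 1"
      by (simp add: complex_eq_iff)
    then obtain k :: int where "2 * pi / real p = of_int k * 2 * pi"
      by (auto simp: cos_one_2pi_int)
    then have "of_int k * real p = 1"
      using p_gt_1 by (simp add: field_simps)
    then have "k * int p = 1"
      by (metis of_int_1 of_int_eq_iff of_int_mult of_int_of_nat_eq)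
    then show False
      using p_gt_1 by (simp add: zmult_eq_1_iff)
  qed
  ultimately show ?thesis
    by metis
qed

lemma sum_psi: "(\<Sum>x\<in>UNIV. \<psi> (b * x)) = (if b = 0 then of_nat (q ^ 2) else 0)"
proof (cases "b = 0")
  case False
  obtain a where "\<psi> a \<noteq> 1"
    using psi_nontrivial by blast
  then have "(\<Sum>x\<in>UNIV. \<psi> (b * x)) = 0"
    using False by (intro sum_nontrivial_character_eq_0[where a = "a / b"]) (simp_all add: psi_add ring_distribs)
  then show ?thesis
    using False by simp
qed (simp add: psi_0 card_UNIV)

text \<open>By Frobenius invariance \<open>z / 2\<close> and its \<open>q\<close>-th power
  contribute the same factor. This rewrites \<psi>(bx) through an element of F_q, so that it can be
  merged with the norm when completing the square.\<close>

lemma psi_half_trace: "\<psi> ((z + z ^ q) / 2) = \<psi> z"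
proof -
  have "(z / 2) ^ q = z ^ q / 2"
    using fixed_field_2[OF q_eq] by (simp add: power_divide fixed_field_def)
  then have "\<psi> (z ^ q / 2) = \<psi> (z / 2)"
    using psi_frob[OF q_eq, of "z / 2"] by metis
  then have "\<psi> ((z + z ^ q) / 2) = \<psi> (z / 2) * \<psi> (z / 2)"
    by (simp add: add_divide_distrib psi_add)
  also have "\<dots> = \<psi> z"
    using two_neq_0 by (simp flip: psi_add)
  finally show ?thesis .
qed

lemma half_trace_in_fixed_field_q: "z + z ^ q \<in> (fixed_field q :: 'a set)"
  using power_q_sq[of z] by (simp add: fixed_field_def frob_add[OF q_eq] power2_eq_square power_mult add.commute)

lemma psi_half_nontrivial: "\<exists>w\<in>fixed_field q. \<psi> (w / 2) \<noteq> 1"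
  using psi_nontrivial psi_half_trace half_trace_in_fixed_field_q by metis

lemma sum_psi_half:
  assumes "y \<in> fixed_field q" "y \<noteq> 0"
  shows "(\<Sum>w\<in>fixed_field q. \<psi> (y * w / 2)) = 0"
proof -
  obtain w where "w \<in> fixed_field q" "\<psi> (w / 2) \<noteq> 1"
    using psi_half_nontrivial by blast
  then show ?thesis
    using assms
    by (intro sum_nontrivial_character_eq_0[where a = "w / y"])
       (simp_all add: fixed_field_divide fixed_field_add[OF q_eq] psi_add ring_distribs add_divide_distrib)
qed

text \<open>\<open>x \<mapsto> \<psi> (\<theta> * x)\<close> plays the role of the canonical additive character of \<open>F_r\<close>: composed with
  the trace from \<open>F_q\<close> it is \<open>w \<mapsto> \<psi> (w / 2)\<close>, and the latter composed with the trace from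
  \<open>F_{q^2}\<close> is \<open>\<psi>\<close>. This avoids transitivity of traces.\<close>
definition \<theta> :: 'a where
  "\<theta> = (SOME x. x \<in> fixed_field q \<and> rel_trace r s x = 1 / 2)"

lemma theta_in: "\<theta> \<in> fixed_field q" and theta_trace: "rel_trace r s \<theta> = 1 / 2"
proof -
  have "1 / 2 \<in> (fixed_field r :: 'a set)"
    by (intro fixed_field_divide fixed_field_1 fixed_field_2[OF r_def])
  then have "\<exists>x. x \<in> fixed_field q \<and> rel_trace r s x = (1 / 2 :: 'a)"
    using rel_trace_onto_r by blast
  then show "\<theta> \<in> fixed_field q" and "rel_trace r s \<theta> = 1 / 2"
    unfolding \<theta>_def by (metis (mono_tags, lifting) someI_ex)+
qed

text \<open>Raising the \<open>i\<close>-th summand to the power \<open>r ^ (s - i)\<close> leaves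
  \<psi> unchanged and returns its factor in \<open>w\<close> to \<open>w ^ q = w\<close>. The
  Frobenius powers thereby move onto \<theta>, whose trace is 1/2.\<close>

lemma psi_theta_trace:
  assumes w: "w \<in> fixed_field q"
  shows "\<psi> (\<theta> * rel_trace r s w) = \<psi> (w / 2)"
proof -
  have step: "\<psi> (\<theta> * w ^ r ^ i) = \<psi> (\<theta> ^ r ^ (s - i) * w)" if "i \<le> s" for i
  proof -
    have "(w ^ r ^ i) ^ r ^ (s - i) = w ^ q"
      using that by (simp add: q_def flip: power_mult power_add)
    then have "(\<theta> * w ^ r ^ i) ^ r ^ (s - i) = \<theta> ^ r ^ (s - i) * w"
      using w by (simp add: power_mult_distrib fixed_field_def)
    moreover have "\<psi> ((\<theta> * w ^ r ^ i) ^ r ^ (s - i)) = \<psi> (\<theta> * w ^ r ^ i)"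
      by (rule psi_frob[of _ "t * (s - i)"]) (simp add: r_def power_mult)
    ultimately show ?thesis
      by simp
  qed
  define g where "g i = \<theta> ^ r ^ i * w" for i
  \<comment> \<open>The exponents \<open>s - i\<close> run over 1 to \<open>s\<close> instead of 0
    to \<open>s - 1\<close>; the ends agree because \<theta> lies in F_q.\<close>
  have "(\<Sum>i<s. g (s - i)) = (\<Sum>i<s. g (Suc i))"
    unfolding sum.nat_diff_reindex[of "\<lambda>i. g (Suc i)" s, symmetric]
    by (rule sum.cong) (simp_all add: Suc_diff_Suc)
  moreover have "(\<Sum>i<s. g (Suc i)) + g 0 = (\<Sum>i<s. g i) + g s"
    using sum.lessThan_Suc_shift[of g s] by (simp add: add.commute)
  moreover have "g s = g 0"
    using theta_in by (simp add: g_def fixed_field_def flip: q_def)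
  ultimately have shift: "(\<Sum>i<s. g (s - i)) = (\<Sum>i<s. g i)"
    by simp
  have "\<psi> (\<theta> * rel_trace r s w) = \<psi> (\<Sum>i<s. g (s - i))"
    by (simp add: rel_trace_def sum_distrib_left psi_sum step g_def)
  also have "(\<Sum>i<s. g (s - i)) = rel_trace r s \<theta> * w"
    unfolding shift by (simp add: rel_trace_def sum_distrib_right g_def)
  finally show ?thesis
    by (simp add: theta_trace)
qed

lemma psi_theta_mult_trace:
  assumes "w \<in> fixed_field q" "c \<in> fixed_field r"
  shows "\<psi> (\<theta> * (c * rel_trace r s w)) = \<psi> (c * w / 2)"
proof -
  have "c ^ r ^ i = c" for i
    using fixed_field_power[OF assms(2)] by (simp add: fixed_field_def)
  then have "c * rel_trace r s w = rel_trace r s (c * w)"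
    by (simp add: rel_trace_def sum_distrib_left power_mult_distrib)
  moreover have "c * w \<in> fixed_field q"
    using assms fixed_field_r_subset fixed_field_mult by blast
  ultimately show ?thesis
    using psi_theta_trace by simp
qed

lemma sum_psi_theta:
  assumes "c \<in> fixed_field r"
  shows "(\<Sum>y\<in>fixed_field r. \<psi> (\<theta> * (c * y))) = (if c = 0 then of_nat r else 0)"
proof (cases "c = 0")
  case False
  obtain w where w: "w \<in> fixed_field q" "\<psi> (w / 2) \<noteq> 1"
    using psi_half_nontrivial by blast
  have "rel_trace r s w \<in> fixed_field r"
    using w rel_trace_in_fixed_field[OF r_def] by (simp add: q_def)
  then have "(\<Sum>y\<in>fixed_field r. \<psi> (\<theta> * (c * y))) = 0"
    \<comment> \<open>The witness is scaled by \<open>1 / c\<close>, so that the character takes the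
      nontrivial value \<psi>(w/2) there.\<close>
    using assms False w psi_theta_trace[OF w(1)]
    by (intro sum_nontrivial_character_eq_0[where a = "rel_trace r s w / c"])
       (simp_all add: fixed_field_divide fixed_field_add[OF r_def] psi_add ring_distribs)
  then show ?thesis
    using False by simp
qed (simp add: psi_0 card_fixed_field_r)

subsection \<open>The Hermitian form\<close>

definition Q :: "'a \<Rightarrow> 'a" where
  "Q x = rel_trace r s (x ^ (q + 1))"

lemma norm_in_fixed_field_q: "x ^ (q + 1) \<in> (fixed_field q :: 'a set)"
proof -
  have "(x ^ (q + 1)) ^ q = x ^ q ^ 2 * x ^ q"
    by (simp add: power_mult_distrib power2_eq_square mult.commute flip: power_mult)
  then show ?thesis
    by (simp add: fixed_field_def power_q_sq)
qed

lemma Q_in: "Q x \<in> fixed_field r"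
  unfolding Q_def using rel_trace_in_fixed_field[OF r_def] norm_in_fixed_field_q by (simp add: q_def)

lemma Q_0: "Q 0 = 0"
  using r_gt_1 by (simp add: Q_def rel_trace_def power_0_left)

text \<open>The norm sends the \<open>(q - 1) * (q + 1)\<close> units of F_{q^2} to the at most
  \<open>q - 1\<close> units of F_q, and each fibre has at most \<open>q + 1\<close> elements, so
  all fibres are full.\<close>

lemma norm_fibre:
  assumes "w \<in> fixed_field q - {0}"
  shows "card {x \<in> UNIV - {0}. x ^ (q + 1) = (w :: 'a)} = q + 1"
proof (rule fibres_full(2)[of "UNIV - {0}" "fixed_field q - {0}" _ "q - 1"])
  show "(\<lambda>x :: 'a. x ^ (q + 1)) ` (UNIV - {0}) \<subseteq> fixed_field q - {0}"
    using norm_in_fixed_field_q by auto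
  show "card (fixed_field q - {0 :: 'a}) \<le> q - 1"
    using fixed_field_0[where ?'a = 'a, of q] q_gt_1 by (subst card_Diff_singleton) (auto simp: card_fixed_field_q)
  show "card (UNIV - {0 :: 'a}) = (q - 1) * (q + 1)"
    by (simp add: card_UNIV power2_eq_square algebra_simps)
  show "card {x \<in> UNIV - {0}. x ^ (q + 1) = y} \<le> q + 1" for y :: 'a
    by (rule order_trans[OF card_mono card_power_eq_le[of "q + 1" y]]) auto
qed (use assms in simp_all)

text \<open>Every nonzero value of the norm occurs \<open>q + 1\<close> times but 0 only once,
  whence the correction by \<open>q * g 0\<close>.\<close>

lemma sum_norm:
  fixes g :: "'a \<Rightarrow> complex"
  shows "(\<Sum>x\<in>UNIV. g (x ^ (q + 1))) = (of_nat q + 1) * (\<Sum>w\<in>fixed_field q. g w) - of_nat q * g 0"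
proof -
  have "(\<Sum>x\<in>UNIV - {0}. g (x ^ (q + 1)))
      = (\<Sum>w\<in>fixed_field q - {0}. \<Sum>x\<in>{x \<in> UNIV - {0}. x ^ (q + 1) = w}. g (x ^ (q + 1)))"
    by (rule sum.group[symmetric]) (use norm_in_fixed_field_q in auto)
  also have "\<dots> = (\<Sum>w\<in>fixed_field q - {0}. (of_nat q + 1) * g w)"
    using norm_fibre by (intro sum.cong) simp_all
  also have "\<dots> = (of_nat q + 1) * ((\<Sum>w\<in>fixed_field q. g w) - g 0)"
    using fixed_field_0[where ?'a = 'a, of q] q_gt_1 by (simp add: sum_distrib_left[symmetric] sum_diff1)
  finally show ?thesis
    by (simp add: sum.remove[of UNIV 0] algebra_simps)
qed

lemma hermitian_gauss_sum:
  assumes y: "y \<in> fixed_field r" "y \<noteq> 0"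
  shows "(\<Sum>x\<in>UNIV. \<psi> (\<theta> * (y * Q x)) * \<psi> (b * x)) = - of_nat q * \<psi> (\<theta> * (- Q b * (1 / y)))"
proof -
  \<comment> \<open>The shift completing the square: \<open>y * x * u ^ q = b * x\<close>,
    \<open>y * u * x ^ q = (b * x) ^ q\<close>, and
    \<open>y * u ^ (q + 1) = b ^ (q + 1) / y\<close>.\<close>
  define u where "u = b ^ q / y"
  have yq: "y \<in> fixed_field q"
    using y fixed_field_r_subset by blast
  have uq: "u ^ q = b / y"
    using yq power_q_sq[of b]
    by (simp add: u_def power_divide fixed_field_def power2_eq_square flip: power_mult)
  have square: "y * x ^ (q + 1) + (b * x + (b * x) ^ q) = y * (x + u) ^ (q + 1) - b ^ (q + 1) / y" for x
  proof -
    have "(x + u) ^ (q + 1) = (x + u) * (x ^ q + b / y)"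
      by (simp add: frob_add[OF q_eq] uq)
    then show ?thesis
      using y(2) by (simp add: u_def power_mult_distrib field_simps)
  qed
  have "\<psi> (\<theta> * (y * Q x)) * \<psi> (b * x) = \<psi> (y * (x + u) ^ (q + 1) / 2) * \<psi> (- (b ^ (q + 1) / y / 2))" for x
  proof -
    have "\<psi> (\<theta> * (y * Q x)) * \<psi> (b * x) = \<psi> (y * x ^ (q + 1) / 2) * \<psi> ((b * x + (b * x) ^ q) / 2)"
      unfolding Q_def psi_half_trace using psi_theta_mult_trace[OF norm_in_fixed_field_q y(1)] by simp
    also have "\<dots> = \<psi> ((y * (x + u) ^ (q + 1) - b ^ (q + 1) / y) / 2)"
      unfolding psi_add[symmetric] square[symmetric] by (simp add: add_divide_distrib)
    finally show ?thesis
      by (simp add: diff_divide_distrib flip: psi_add)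
  qed
  moreover have "\<psi> (- (b ^ (q + 1) / y / 2)) = \<psi> (\<theta> * (- Q b * (1 / y)))"
  proof -
    have "- 1 / y \<in> fixed_field r"
      using y by (simp add: fixed_field_divide fixed_field_uminus[OF r_def] fixed_field_1)
    from psi_theta_mult_trace[OF norm_in_fixed_field_q this, of b] show ?thesis
      by (simp add: Q_def)
  qed
  moreover have "(\<Sum>x\<in>UNIV. \<psi> (y * (x + u) ^ (q + 1) / 2)) = - of_nat q"
  proof -
    have "(\<Sum>x\<in>UNIV. \<psi> (y * (x + u) ^ (q + 1) / 2)) = (\<Sum>x\<in>UNIV. \<psi> (y * x ^ (q + 1) / 2))"
      by (rule sum.reindex_bij_witness[of _ "\<lambda>x. x - u" "\<lambda>x. x + u"]) simp_all
    \<comment> \<open>The sum over F_q vanishes by orthogonality, so only the correction term at 0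
      survives.\<close>
    also have "\<dots> = - of_nat q"
      using sum_norm[of "\<lambda>w. \<psi> (y * w / 2)"] sum_psi_half[OF yq y(2)] by (simp add: psi_0)
    finally show ?thesis .
  qed
  ultimately show ?thesis
    by (simp flip: sum_distrib_right)
qed

subsection \<open>The quadratic character\<close>

abbreviation \<eta> :: "'a \<Rightarrow> int" where
  "\<eta> \<equiv> quad_char r"

lemma eta_0: "\<eta> 0 = 0" and eta_1: "\<eta> 1 = 1"
proof -
  show "\<eta> 0 = 0"
    by (simp add: quad_char_def)
  have "\<exists>z :: 'a. z ^ r = z \<and> z\<^sup>2 = 1"
    by (rule exI[of _ 1]) simp
  then show "\<eta> 1 = 1"
    by (simp add: quad_char_def)
qed

lemma eta_eq_0_iff: "\<eta> y = 0 \<longleftrightarrow> y = 0"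
  by (simp add: quad_char_def)

lemma eta_values: "\<eta> y \<in> {-1, 0, 1}"
  by (simp add: quad_char_def)

lemma half_r: "2 * ((r - 1) div 2) = r - 1" "(r - 1) div 2 > 0"
proof -
  have "even (r - 1)" "r \<noteq> 2"
    using odd_r by auto
  then show "2 * ((r - 1) div 2) = r - 1" "(r - 1) div 2 > 0"
    using r_gt_1 by auto
qed

lemma fixed_field_r_power:
  assumes "y \<in> fixed_field r" "y \<noteq> (0 :: 'a)"
  shows "y ^ (r - 1) = 1"
proof -
  have "y ^ (r - 1) * y = 1 * y"
    using assms(1) r_gt_1 by (simp add: fixed_field_def flip: power_Suc2)
  then show ?thesis
    using assms(2) by simp
qed

lemma card_units_r: "card (fixed_field r - {0 :: 'a}) = r - 1"
  using fixed_field_0[where ?'a = 'a, of r] r_gt_1 by (subst card_Diff_singleton) (auto simp: card_fixed_field_r)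

lemma euler_power_values:
  assumes "y \<in> fixed_field r" "y \<noteq> (0 :: 'a)"
  shows "y ^ ((r - 1) div 2) \<in> {1, -1}"
proof -
  have "(y ^ ((r - 1) div 2))\<^sup>2 = 1"
    using fixed_field_r_power[OF assms] half_r by (simp flip: power_mult add: mult.commute)
  then show ?thesis
    by (simp add: power2_eq_1_iff)
qed

text \<open>The \<open>r - 1\<close> units of F_r take only the values 1 and -1, each at most
  \<open>(r - 1) div 2\<close> times.\<close>

lemma euler_fibre:
  assumes "e \<in> {1, -1}"
  shows "card {y \<in> fixed_field r - {0 :: 'a}. y ^ ((r - 1) div 2) = e} = (r - 1) div 2"
proof (rule fibres_full(2)[of "fixed_field r - {0 :: 'a}" "{1, -1}" _ 2])
  show "card {y \<in> fixed_field r - {0 :: 'a}. y ^ ((r - 1) div 2) = e} \<le> (r - 1) div 2" for e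
    by (rule order_trans[OF card_mono card_power_eq_le[of "(r - 1) div 2" e]]) (use half_r in auto)
  show "card {1, - 1 :: 'a} \<le> 2"
    by (simp add: card_insert_if)
qed (use assms half_r euler_power_values in \<open>auto simp: card_units_r\<close>)

text \<open>Squaring is at most two-to-one on units, so there are at least
  \<open>(r - 1) div 2\<close> squares, which is the size of the set on the right that contains
  them.\<close>

lemma squares_eq:
  "(\<lambda>z. z\<^sup>2) ` (fixed_field r - {0 :: 'a}) = {y \<in> fixed_field r - {0}. y ^ ((r - 1) div 2) = 1}"
proof (rule card_seteq)
  let ?S = "(\<lambda>z :: 'a. z\<^sup>2) ` (fixed_field r - {0})"
  have "z\<^sup>2 ^ ((r - 1) div 2) = 1" if "z \<in> fixed_field r - {0}" for z :: 'a
    using fixed_field_r_power that half_r(1) by (simp flip: power_mult)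
  then show "?S \<subseteq> {y \<in> fixed_field r - {0}. y ^ ((r - 1) div 2) = 1}"
    using fixed_field_mult by (auto simp: power2_eq_square)
  have "r - 1 = (\<Sum>y\<in>?S. card {z \<in> fixed_field r - {0}. z\<^sup>2 = y})"
    using sum.group[of "fixed_field r - {0}" ?S "\<lambda>z. z\<^sup>2" "\<lambda>_. 1 :: nat"] by (simp add: card_units_r)
  also have "\<dots> \<le> (\<Sum>y\<in>?S. 2)"
    by (intro sum_mono order_trans[OF card_mono card_power_eq_le[of 2]]) auto
  finally show "card {y \<in> fixed_field r - {0 :: 'a}. y ^ ((r - 1) div 2) = 1} \<le> card ?S"
    unfolding euler_fibre[OF insertI1] by simp
qed simp

lemma eta_euler:
  assumes "y \<in> fixed_field r"
  shows "of_int (\<eta> y) = (y :: 'a) ^ ((r - 1) div 2)"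
proof (cases "y = 0")
  case True
  then show ?thesis
    using half_r by (simp add: eta_0 power_0_left)
next
  case False
  then have "(\<exists>z. z ^ r = z \<and> z\<^sup>2 = y) \<longleftrightarrow> y \<in> (\<lambda>z. z\<^sup>2) ` (fixed_field r - {0})"
    by (auto simp: fixed_field_def)
  also have "\<dots> \<longleftrightarrow> y ^ ((r - 1) div 2) = 1"
    using assms False by (auto simp: squares_eq)
  finally show ?thesis
    using False euler_power_values[OF assms False] by (auto simp: quad_char_def)
qed

text \<open>In odd characteristic -1, 0 and 1 stay distinct. Identities for \<eta> can thus be
  checked in the field, where Euler's criterion turns it into a power.\<close>

lemma of_int_eta_inj:
  assumes "a \<in> {-1, 0, 1}" "b \<in> {-1, 0, 1}" "of_int a = (of_int b :: 'a)"
  shows "a = b"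
proof -
  have "(1 :: 'a) \<noteq> - 1"
    unfolding eq_neg_iff_add_eq_0 using two_neq_0 by simp
  moreover from this have "- 1 \<noteq> (1 :: 'a)"
    by (rule not_sym)
  ultimately show ?thesis
    using assms by auto
qed

lemma eta_mult:
  assumes "x \<in> fixed_field r" "y \<in> fixed_field r"
  shows "\<eta> (x * y) = \<eta> x * \<eta> y"
proof (rule of_int_eta_inj)
  show "of_int (\<eta> (x * y)) = (of_int (\<eta> x * \<eta> y) :: 'a)"
    using assms by (simp add: eta_euler fixed_field_mult power_mult_distrib)
  show "\<eta> x * \<eta> y \<in> {-1, 0, 1}"
    using eta_values[of x] eta_values[of y] by auto
qed (rule eta_values)

lemma eta_inverse:
  assumes "y \<in> fixed_field r"
  shows "\<eta> (1 / y) = \<eta> y"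
proof (cases "y = 0")
  case False
  then have "\<eta> (1 / y) * \<eta> y = 1"
    using eta_mult[of "1 / y" y] assms by (simp add: fixed_field_divide fixed_field_1 eta_1)
  then show ?thesis
    using eta_values[of y] eta_values[of "1 / y"] by auto
qed simp

text \<open>Multiplication by a nonsquare permutes F_r and reverses the sign of \<eta>.\<close>

lemma sum_eta: "(\<Sum>y\<in>fixed_field r. \<eta> y) = 0"
proof -
  have "{y \<in> fixed_field r - {0 :: 'a}. y ^ ((r - 1) div 2) = - 1} \<noteq> {}"
    using euler_fibre[of "- 1"] half_r by (metis card.empty insertCI less_irrefl)
  then obtain a :: 'a where a: "a \<in> fixed_field r" "a \<noteq> 0" "a ^ ((r - 1) div 2) = - 1"
    by auto
  have "\<eta> a = - 1"
    by (rule of_int_eta_inj) (use a eta_values in \<open>auto simp: eta_euler\<close>)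
  have "(\<Sum>y\<in>fixed_field r. \<eta> y) = (\<Sum>y\<in>fixed_field r. \<eta> (a * y))"
    by (rule sum.reindex_bij_witness[of _ "\<lambda>y. a * y" "\<lambda>y. y / a"])
       (use a in \<open>auto simp: fixed_field_mult fixed_field_divide\<close>)
  also have "\<dots> = - (\<Sum>y\<in>fixed_field r. \<eta> y)"
    using a \<open>\<eta> a = - 1\<close> by (simp add: eta_mult sum_negf)
  finally show ?thesis
    by simp
qed


subsection \<open>The character sums over \<open>D\<close>\<close>

text \<open>The quadratic Gauss sum of F_r.\<close>

definition gauss :: complex where
  "gauss = (\<Sum>y\<in>fixed_field r. of_int (\<eta> y) * \<psi> (\<theta> * y))"

lemma twisted_gauss_sum:
  assumes u: "u \<in> fixed_field r"
  shows "(\<Sum>y\<in>fixed_field r. of_int (\<eta> y) * \<psi> (\<theta> * (u * y))) = of_int (\<eta> u) * gauss"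
proof (cases "u = 0")
  case True
  then show ?thesis
    using sum_eta by (simp add: psi_0 eta_0 flip: of_int_sum)
next
  case False
  have "of_int (\<eta> u) * gauss = (\<Sum>y\<in>fixed_field r. of_int (\<eta> (1 / u) * \<eta> y) * \<psi> (\<theta> * y))"
    by (simp add: gauss_def sum_distrib_left mult.assoc eta_inverse[OF u])
  also have "\<dots> = (\<Sum>y\<in>fixed_field r. of_int (\<eta> (y / u)) * \<psi> (\<theta> * y))"
  proof (rule sum.cong)
    fix y :: 'a
    assume "y \<in> fixed_field r"
    then have "\<eta> (1 / u * y) = \<eta> (1 / u) * \<eta> y"
      using u by (intro eta_mult fixed_field_divide fixed_field_1)
    then show "of_int (\<eta> (1 / u) * \<eta> y) * \<psi> (\<theta> * y) = of_int (\<eta> (y / u)) * \<psi> (\<theta> * y)"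
      by simp
  qed simp
  also have "\<dots> = (\<Sum>y\<in>fixed_field r. of_int (\<eta> y) * \<psi> (\<theta> * (u * y)))"
    by (rule sum.reindex_bij_witness[of _ "\<lambda>y. u * y" "\<lambda>y. y / u"])
       (use u False in \<open>auto simp: fixed_field_mult fixed_field_divide\<close>)
  finally show ?thesis ..
qed

text \<open>If \<open>gauss\<close> vanished, so would the Fourier transform of \<open>\<eta>\<close>, and hence \<open>\<eta> 1\<close> by inversion.\<close>
lemma gauss_neq_0: "gauss \<noteq> 0"
proof
  assume "gauss = 0"
  let ?R = "fixed_field r :: 'a set"
  have "0 = (\<Sum>u\<in>?R. \<psi> (\<theta> * (- u)) * (of_int (\<eta> u) * gauss))"
    by (simp add: \<open>gauss = 0\<close>)
  also have "\<dots> = (\<Sum>u\<in>?R. \<Sum>y\<in>?R. of_int (\<eta> y) * \<psi> (\<theta> * ((y - 1) * u)))"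
  proof (rule sum.cong)
    fix u :: 'a
    assume u: "u \<in> ?R"
    have "\<psi> (\<theta> * (- u)) * \<psi> (\<theta> * (u * y)) = \<psi> (\<theta> * ((y - 1) * u))" for y
      unfolding psi_add[symmetric] by (simp add: algebra_simps)
    then show "\<psi> (\<theta> * (- u)) * (of_int (\<eta> u) * gauss) = (\<Sum>y\<in>?R. of_int (\<eta> y) * \<psi> (\<theta> * ((y - 1) * u)))"
      by (simp add: sum_distrib_left mult.left_commute flip: twisted_gauss_sum[OF u])
  qed simp
  also have "\<dots> = (\<Sum>y\<in>?R. of_int (\<eta> y) * (\<Sum>u\<in>?R. \<psi> (\<theta> * ((y - 1) * u))))"
    by (subst sum.swap) (simp add: sum_distrib_left)
  also have "\<dots> = (\<Sum>y\<in>?R. if y = 1 then of_nat r else 0)"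
  proof (rule sum.cong)
    fix y :: 'a
    assume "y \<in> ?R"
    then have "y - 1 \<in> ?R"
      using fixed_field_add[OF r_def, of y "- 1"] by (simp add: fixed_field_uminus[OF r_def] fixed_field_1)
    then show "of_int (\<eta> y) * (\<Sum>u\<in>?R. \<psi> (\<theta> * ((y - 1) * u))) = (if y = 1 then of_nat r else 0)"
      by (simp add: sum_psi_theta eta_1)
  qed simp
  also have "\<dots> = of_nat r"
    by (simp add: fixed_field_1)
  finally show False
    using r_gt_1 by simp
qed

lemma uminus_Q_in: "- Q b \<in> fixed_field r"
  using Q_in fixed_field_uminus[OF r_def] by blast

lemma sum_eta_Q: "(\<Sum>x\<in>UNIV. of_int (\<eta> (Q x)) * \<psi> (b * x)) = - of_nat q * of_int (\<eta> (- Q b))"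
proof -
  let ?R = "fixed_field r :: 'a set"
  have "(\<Sum>x\<in>UNIV. of_int (\<eta> (Q x)) * \<psi> (b * x)) * gauss
      = (\<Sum>x\<in>UNIV. \<Sum>y\<in>?R. of_int (\<eta> y) * (\<psi> (\<theta> * (y * Q x)) * \<psi> (b * x)))"
    unfolding sum_distrib_right
  proof (rule sum.cong)
    fix x
    have "of_int (\<eta> (Q x)) * \<psi> (b * x) * gauss = (of_int (\<eta> (Q x)) * gauss) * \<psi> (b * x)"
      by simp
    also have "\<dots> = (\<Sum>y\<in>?R. of_int (\<eta> y) * \<psi> (\<theta> * (Q x * y))) * \<psi> (b * x)"
      by (simp only: twisted_gauss_sum[OF Q_in])
    finally show "of_int (\<eta> (Q x)) * \<psi> (b * x) * gauss
        = (\<Sum>y\<in>?R. of_int (\<eta> y) * (\<psi> (\<theta> * (y * Q x)) * \<psi> (b * x)))"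
      by (simp add: sum_distrib_right mult.assoc mult.commute[of _ "Q x"])
  qed simp
  also have "\<dots> = (\<Sum>y\<in>?R. of_int (\<eta> y) * (\<Sum>x\<in>UNIV. \<psi> (\<theta> * (y * Q x)) * \<psi> (b * x)))"
    by (subst sum.swap) (simp add: sum_distrib_left)
  also have "\<dots> = (\<Sum>y\<in>?R. - of_nat q * (of_int (\<eta> (1 / y)) * \<psi> (\<theta> * (- Q b * (1 / y)))))"
  proof (rule sum.cong)
    fix y :: 'a
    assume "y \<in> ?R"
    then show "of_int (\<eta> y) * (\<Sum>x\<in>UNIV. \<psi> (\<theta> * (y * Q x)) * \<psi> (b * x))
        = - of_nat q * (of_int (\<eta> (1 / y)) * \<psi> (\<theta> * (- Q b * (1 / y))))"
      using hermitian_gauss_sum[of y b] by (cases "y = 0") (simp_all add: eta_0 eta_inverse)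
  qed simp
  \<comment> \<open>Inversion permutes all of F_r, as \<open>1 / 0 = 0\<close>; the summand at 0
    vanishes because \<open>\<eta> 0 = 0\<close>.\<close>
  also have "\<dots> = (\<Sum>y\<in>?R. - of_nat q * (of_int (\<eta> y) * \<psi> (\<theta> * (- Q b * y))))"
    by (rule sum.reindex_bij_witness[of _ "\<lambda>y. 1 / y" "\<lambda>y. 1 / y"])
       (simp_all add: fixed_field_divide fixed_field_1)
  also have "\<dots> = - of_nat q * of_int (\<eta> (- Q b)) * gauss"
    unfolding sum_distrib_left[symmetric] twisted_gauss_sum[OF uminus_Q_in] by simp
  finally show ?thesis
    unfolding mult_right_cancel[OF gauss_neq_0] .
qed

lemma sum_Q_eq_0:
  "of_nat r * (\<Sum>x\<in>UNIV. of_bool (Q x = 0) * \<psi> (b * x))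
    = (if b = 0 then of_nat (q ^ 2) else 0) - of_nat q * ((if Q b = 0 then of_nat r else 0) - 1)"
proof -
  let ?R = "fixed_field r :: 'a set"
  have R0: "(0 :: 'a) \<in> ?R"
    using fixed_field_0[where ?'a = 'a, of r] r_gt_1 by simp
  have "of_nat r * (\<Sum>x\<in>UNIV. of_bool (Q x = 0) * \<psi> (b * x))
      = (\<Sum>x\<in>UNIV. \<Sum>y\<in>?R. \<psi> (\<theta> * (y * Q x)) * \<psi> (b * x))"
    unfolding sum_distrib_left
  proof (rule sum.cong)
    fix x
    have "of_nat r * (of_bool (Q x = 0) * \<psi> (b * x)) = (\<Sum>y\<in>?R. \<psi> (\<theta> * (Q x * y))) * \<psi> (b * x)"
      unfolding sum_psi_theta[OF Q_in] by simp
    then show "of_nat r * (of_bool (Q x = 0) * \<psi> (b * x)) = (\<Sum>y\<in>?R. \<psi> (\<theta> * (y * Q x)) * \<psi> (b * x))"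
      by (simp add: sum_distrib_right mult.commute[of _ "Q x"])
  qed simp
  also have "\<dots> = (\<Sum>y\<in>?R. \<Sum>x\<in>UNIV. \<psi> (\<theta> * (y * Q x)) * \<psi> (b * x))"
    by (rule sum.swap)
  also have "\<dots> = (\<Sum>x\<in>UNIV. \<psi> (b * x))
      + (\<Sum>y\<in>?R - {0}. \<Sum>x\<in>UNIV. \<psi> (\<theta> * (y * Q x)) * \<psi> (b * x))"
    using R0 by (subst sum.remove[of _ 0]) (simp_all add: psi_0)
  also have "(\<Sum>y\<in>?R - {0}. \<Sum>x\<in>UNIV. \<psi> (\<theta> * (y * Q x)) * \<psi> (b * x))
      = (\<Sum>y\<in>?R - {0}. - of_nat q * \<psi> (\<theta> * (- Q b * (1 / y))))"
    using hermitian_gauss_sum by (intro sum.cong) auto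
  also have "\<dots> = (\<Sum>y\<in>?R - {0}. - of_nat q * \<psi> (\<theta> * (- Q b * y)))"
    by (rule sum.reindex_bij_witness[of _ "\<lambda>y. 1 / y" "\<lambda>y. 1 / y"])
       (auto simp: fixed_field_divide fixed_field_1)
  \<comment> \<open>Putting \<open>y = 0\<close> back makes orthogonality applicable and costs the
    1.\<close>
  also have "\<dots> = - of_nat q * ((\<Sum>y\<in>?R. \<psi> (\<theta> * (- Q b * y))) - 1)"
    unfolding sum_distrib_left[symmetric] using R0 by (simp add: sum_diff1 psi_0)
  finally show ?thesis
    unfolding sum_psi sum_psi_theta[OF uminus_Q_in] by simp
qed

text \<open>This is the set \<open>D\<close> of the theorem.\<close>

definition nonsquare_Q :: "'a set" where
  "nonsquare_Q = {x. \<eta> (Q x) = - 1}"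

text \<open>Twice the indicator of \<open>nonsquare_Q\<close> is 1 minus the indicator of
  \<open>Q x = 0\<close> minus \<open>\<eta> (Q x)\<close>; each of the three resulting sums is
  known.\<close>

lemma sum_D:
  "2 * of_nat r * (\<Sum>x\<in>nonsquare_Q. \<psi> (b * x))
    = (of_nat r - 1) * (if b = 0 then of_nat (q ^ 2) else 0)
      + of_nat q * ((if Q b = 0 then of_nat r else 0) - 1) + of_nat r * of_nat q * of_int (\<eta> (- Q b))"
proof -
  have ind: "2 * of_bool (x \<in> nonsquare_Q) = 1 - of_bool (Q x = 0) - (of_int (\<eta> (Q x)) :: complex)" for x
    using eta_values[of "Q x"] by (auto simp: nonsquare_Q_def eta_0 eta_eq_0_iff)
  have pointwise: "2 * (of_bool (x \<in> nonsquare_Q) * \<psi> (b * x))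
      = \<psi> (b * x) - of_bool (Q x = 0) * \<psi> (b * x) - of_int (\<eta> (Q x)) * \<psi> (b * x)" for x
    unfolding mult.assoc[symmetric] ind by (simp add: left_diff_distrib)
  have "(\<Sum>x\<in>nonsquare_Q. \<psi> (b * x)) = (\<Sum>x\<in>UNIV. of_bool (x \<in> nonsquare_Q) * \<psi> (b * x))"
    by (rule sum.mono_neutral_cong_left) auto
  then have "2 * (\<Sum>x\<in>nonsquare_Q. \<psi> (b * x)) = (\<Sum>x\<in>UNIV. \<psi> (b * x))
      - (\<Sum>x\<in>UNIV. of_bool (Q x = 0) * \<psi> (b * x)) - (\<Sum>x\<in>UNIV. of_int (\<eta> (Q x)) * \<psi> (b * x))"
    by (simp only: sum_distrib_left pointwise sum_subtractf)
  then have "of_nat r * (2 * (\<Sum>x\<in>nonsquare_Q. \<psi> (b * x))) = of_nat r * (\<Sum>x\<in>UNIV. \<psi> (b * x))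
      - of_nat r * (\<Sum>x\<in>UNIV. of_bool (Q x = 0) * \<psi> (b * x))
      - of_nat r * (\<Sum>x\<in>UNIV. of_int (\<eta> (Q x)) * \<psi> (b * x))"
    by (simp add: right_diff_distrib)
  then show ?thesis
    unfolding sum_Q_eq_0 sum_eta_Q sum_psi by (simp add: algebra_simps split del: if_split)
qed

section \<open>Cardinalities and the two values of the character sum\<close>

lemma card_D: "2 * real r * real (card nonsquare_Q) = real q * (real q + 1) * (real r - 1)"
proof -
  have "complex_of_real (2 * real r * real (card nonsquare_Q)) = complex_of_real (real q * (real q + 1) * (real r - 1))"
    using sum_D[of 0] by (simp add: psi_0 Q_0 eta_0 algebra_simps power2_eq_square)
  then show ?thesis
    by (simp only: of_real_eq_iff)
qed

text \<open>The character sum at \<open>b\<close> depends on the sign of \<open>- Q b\<close>,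
  whereas \<open>K\<close> counts values of \<open>Q\<close>. Both counts are half the number of
  points with \<open>Q\<close> nonzero, because \<eta> sums to 0 along \<open>Q\<close> and hence,
  up to the factor \<open>\<eta> (- 1)\<close>, along \<open>- Q\<close>.\<close>

lemma card_eta_uminus_Q: "card {b. \<eta> (- Q b) = - 1} = card nonsquare_Q"
proof -
  have eta0: "(\<Sum>x\<in>UNIV. \<eta> (Q x)) = 0"
  proof -
    have "complex_of_int (\<Sum>x\<in>UNIV. \<eta> (Q x)) = 0"
      using sum_eta_Q[of 0] by (simp add: psi_0 Q_0 eta_0)
    then show ?thesis
      by (simp only: of_int_eq_0_iff)
  qed
  have "\<eta> (- Q x) = \<eta> (- 1) * \<eta> (Q x)" for x
    using eta_mult[of "- 1" "Q x"] Q_in by (simp add: fixed_field_uminus[OF r_def] fixed_field_1)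
  then have eta1: "(\<Sum>x\<in>UNIV. \<eta> (- Q x)) = 0"
    using eta0 by (simp flip: sum_distrib_left)
  have count: "2 * int (card {x. \<eta> (f x) = - 1}) = int (card {x. f x \<noteq> 0}) - (\<Sum>x\<in>UNIV. \<eta> (f x))" for f :: "'a \<Rightarrow> 'a"
  proof -
    have "2 * of_bool (\<eta> y = - 1) = of_bool (y \<noteq> 0) - \<eta> y" for y
      using eta_values[of y] by (auto simp: eta_0 eta_eq_0_iff)
    then have "(\<Sum>x\<in>UNIV. 2 * of_bool (\<eta> (f x) = - 1)) = (\<Sum>x\<in>UNIV. of_bool (f x \<noteq> 0) - \<eta> (f x))"
      by simp
    then show ?thesis
      by (simp add: sum_subtractf flip: sum_distrib_left)
  qed
  show ?thesis
    using count[of Q] count[of "\<lambda>x. - Q x"] eta0 eta1 by (simp add: nonsquare_Q_def)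
qed

text \<open>If \<open>Q b = 0\<close> the contribution is \<open>q * (r - 1)\<close>; if
  \<open>\<eta> (- Q b) = 1\<close> it is \<open>- q + r * q\<close>, which is the same. Hence only
  two values occur.\<close>

lemma sum_D_cases:
  assumes "b \<noteq> 0"
  shows "(\<Sum>x\<in>nonsquare_Q. \<psi> (b * x)) = complex_of_real
    (if \<eta> (- Q b) = - 1 then (- real r - 1) / (2 * real r) * real q else (real r - 1) / (2 * real r) * real q)"
proof -
  have "2 * of_nat r * (\<Sum>x\<in>nonsquare_Q. \<psi> (b * x))
      = of_nat q * (if \<eta> (- Q b) = - 1 then - of_nat r - 1 else of_nat r - 1)"
    using sum_D[of b] assms eta_values[of "- Q b"] eta_eq_0_iff[of "- Q b"] by (auto simp: algebra_simps eta_0)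
  then show ?thesis
    using r_gt_1 by (auto simp: field_simps)
qed

lemma card_pairs_diff:
  fixes P :: "'a \<Rightarrow> bool"
  shows "card {(a, b). a \<noteq> b \<and> P (a - b)} = card {d. d \<noteq> 0 \<and> P d} * q ^ 2"
proof -
  have "bij_betw (\<lambda>(a, b). (a - b, b)) {(a, b). a \<noteq> b \<and> P (a - b)} ({d. d \<noteq> 0 \<and> P d} \<times> UNIV)"
    by (rule bij_betw_byWitness[of _ "\<lambda>(d, b). (d + b, b)"]) auto
  then show ?thesis
    by (simp add: bij_betw_same_card card_cartesian_product card_UNIV)
qed


end

section \<open>Values and multiplicities of the inner products\<close>

theorem mainTheorem6:
  fixes p t s :: nat
    and D :: "'a::{finite,field} set"
    and K :: nat and r q T :: nat
    and ip :: "'a \<Rightarrow> 'a \<Rightarrow> complex"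
  assumes "prime p" and "odd p" and "t > 0" and "s > 0"
    and r_def: "r = p ^ t" and q_def: "q = r ^ s" and T_def: "T = q + 1"
    and card: "card (UNIV :: 'a set) = q ^ 2"
    and D_def: "D = {x. quad_char r (rel_trace r s (x ^ T)) = -1}"
    and K_def: "K = card D"
    and ip_def: "\<And>a b. ip a b = (1 / of_nat K) * (\<Sum>x\<in>D. add_char p (2 * t * s) a x * cnj (add_char p (2 * t * s) b x))"
  shows "real K = real q * (real q + 1) * (real r - 1) / (2 * real r)
    \<and> real (card {(a, b). a \<noteq> b \<and> ip a b = complex_of_real ((1 / real K) * ((real r - 1) / (2 * real r) * real q))})
        = (real r + 1) / (2 * real r) * real q ^ 4 - (real r - 1) / (2 * real r) * real q ^ 3 - real q ^ 2
    \<and> real (card {(a, b). a \<noteq> b \<and> ip a b = complex_of_real ((1 / real K) * ((- real r - 1) / (2 * real r) * real q))})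
        = (real r - 1) / (2 * real r) * (real q ^ 4 + real q ^ 3)"
proof -
  interpret odd_field_tower "TYPE('a)" p t s r q
    using assms by unfold_locales auto
  have D: "D = nonsquare_Q"
    unfolding D_def nonsquare_Q_def Q_def T_def ..
  have r: "real r > 0" and q: "real q > 0"
    using r_gt_1 q_gt_1 by simp_all
  have K: "2 * real r * real K = real q * (real q + 1) * (real r - 1)"
    using card_D by (simp add: K_def D)
  have "0 < 2 * real r * real K"
    unfolding K using r_gt_1 q by simp
  then have K_pos: "real K > 0"
    using r by (simp add: zero_less_mult_iff)
  \<comment> \<open>Conjugation negates the argument of \<psi>, so the inner product depends only on
    \<open>a - b\<close>.\<close>
  have ip: "ip a b = (1 / of_nat K) * (\<Sum>x\<in>nonsquare_Q. \<psi> ((a - b) * x))" for a b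
    unfolding ip_def D m_def[symmetric] add_char_eq[of a] add_char_eq[of b] psi_uminus[symmetric] psi_add[symmetric]
    by (simp add: algebra_simps)
  define v where "v d = (if \<eta> (- Q d) = - 1 then (- real r - 1) / (2 * real r) * real q
      else (real r - 1) / (2 * real r) * real q)" for d
  have pairs: "card {(a, b). a \<noteq> b \<and> ip a b = complex_of_real ((1 / real K) * c)} = card {d. d \<noteq> 0 \<and> v d = c} * q ^ 2" for c
  proof -
    have "ip a b = complex_of_real ((1 / real K) * c) \<longleftrightarrow> v (a - b) = c" if "a \<noteq> b" for a b
    proof -
      have "ip a b = complex_of_real ((1 / real K) * v (a - b))"
        using sum_D_cases[of "a - b"] that by (simp add: ip v_def)
      then show ?thesis
        using K_pos by (simp only: of_real_eq_iff) simp
    qed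
    then have "{(a, b). a \<noteq> b \<and> ip a b = complex_of_real ((1 / real K) * c)} = {(a, b). a \<noteq> b \<and> v (a - b) = c}"
      by auto
    then show ?thesis
      using card_pairs_diff[of "\<lambda>d. v d = c"] by simp
  qed
  let ?N = "{d. \<eta> (- Q d) = - 1}"
  have distinct: "(- real r - 1) / (2 * real r) * real q \<noteq> (real r - 1) / (2 * real r) * real q"
    using r q by (simp add: field_simps)
  have N0: "0 \<notin> ?N"
    by (simp add: Q_0 eta_0)
  have "{d. d \<noteq> 0 \<and> v d = (- real r - 1) / (2 * real r) * real q} = ?N"
    using distinct N0 by (auto simp: v_def)
  then have card_neg: "card {d. d \<noteq> 0 \<and> v d = (- real r - 1) / (2 * real r) * real q} = K"
    using card_eta_uminus_Q by (simp add: K_def D)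
  \<comment> \<open>The formula \<open>v\<close> also gives the positive value at 0, which is not a
    difference of distinct elements and must be removed along with \<open>?N\<close>; this leaves
    \<open>q ^ 2 - 1 - K\<close> differences.\<close>
  have "{d. d \<noteq> 0 \<and> v d = (real r - 1) / (2 * real r) * real q} = UNIV - insert 0 ?N"
    using distinct by (auto simp: v_def)
  then have "card {d. d \<noteq> 0 \<and> v d = (real r - 1) / (2 * real r) * real q} + Suc K = q ^ 2"
    using N0 card_eta_uminus_Q card_Diff_subset[of "insert 0 ?N" UNIV] card_mono[of UNIV "insert 0 ?N"]
    by (simp add: card_UNIV K_def D)
  then have card_pos: "real (card {d. d \<noteq> 0 \<and> v d = (real r - 1) / (2 * real r) * real q}) = real q ^ 2 - 1 - real K"
    by (simp add: algebra_simps flip: of_nat_power of_nat_add)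
  have K_eq: "real K = real q * (real q + 1) * (real r - 1) / (2 * real r)"
    using K r by (simp add: field_simps)
  show ?thesis
    unfolding pairs of_nat_mult card_neg card_pos unfolding K_eq
    using r by (simp add: field_simps power2_eq_square power4_eq_xxxx power3_eq_cube)
qed

end
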